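(* Let $A^{(n)}$ be a non-empty finite set with $n$ elements and let $G=G_{A^{(n)}}$ be the corresponding set-graph. Then the curling number of $G$ is $cn(G)=\binom{n}{\lfloor n/2\rfloor}$ and the compound curling number of $G$ is $cn^c(G)=\prod_{i=1}^{n}\binom{n}{i}$.
   Context: The set-graph $G_{A^{(n)}}$ of a set $A^{(n)}=\{a_1,\dots,a_n\}$, $n\in\mathbb{N}$, has one vertex for each non-empty subset of $A^{(n)}$, and two distinct vertices are adjacent if and only if the corresponding subsets have non-empty intersection. For a finite non-empty string $S$ of non-negative integers, $cn(S)$ is the largest $k$ such that $S=X\circ Y^k$, with $\circ$ concatenation, $X$ a possibly empty prefix and $Y$ a non-empty string. The curling number $cn(G)$ of a graph $G$ is the maximum of $cn(S_0)$ over all re-arrangements $S_0$ of its degree sequence. Write the degree sequence of $G$, after re-arrangement, as a string of identity subsequences $(d_1)^{k_1}\circ\cdots\circ(d_r)^{k_r}$, where $d_1,\dots,d_r$ are the distinct degrees and $k_i$ is the number of vertices of degree $d_i$. The compound curling number of $G$ is $cn^c(G)=\prod_{i=1}^{r}k_i$. *)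

theory Defs
  imports Main "HOL-Library.Multiset"
begin

record 'v graph =
  verts :: "'v set"
  edges :: "'v set set"

definition finite_simple_graph :: "'v graph \<Rightarrow> bool" where
  "finite_simple_graph G \<longleftrightarrow>
     finite (verts G) \<and> (\<forall>e\<in>edges G. e \<subseteq> verts G \<and> card e = 2)"

text \<open>Counting incident edges is the vertex degree because simple graphs have no loops.\<close>

definition degree :: "'v graph \<Rightarrow> 'v \<Rightarrow> nat" where
  "degree G v = card {e \<in> edges G. v \<in> e}"

definition set_graph :: "'a set \<Rightarrow> 'a set graph" where
  "set_graph A =
     \<lparr> verts = {B. B \<subseteq> A \<and> B \<noteq> {}},
       edges = {{B, C} | B C. B \<subseteq> A \<and> B \<noteq> {} \<and> C \<subseteq> A \<and> C \<noteq> {} \<and> B \<noteq> C \<and> B \<inter> C \<noteq> {}} \<rparr>"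

lemma finite_simple_graph_set_graph:
  "finite A \<Longrightarrow> finite_simple_graph (set_graph A)"
  unfolding finite_simple_graph_def set_graph_def by (fastforce simp: card_2_iff)

text \<open>The set below contains 0 and is bounded by the length of \<open>S\<close> (as \<open>Y\<close> is non-empty),
  so the maximum is attained.\<close>

definition curling_number :: "nat list \<Rightarrow> nat" where
  "curling_number S = Max {k. \<exists>X Y. Y \<noteq> [] \<and> S = X @ concat (replicate k Y)}"

text \<open>All arrangements of the degree sequence of a finite graph; each vertex contributes one
  entry.\<close>

definition degree_sequences :: "'v graph \<Rightarrow> nat list set" where
  "degree_sequences G = {S. mset S = image_mset (degree G) (mset_set (verts G))}"

text \<open>For a finite graph there are finitely many, and at least one, arrangements, so this
  maximum is attained as well.\<close>

definition graph_curling_number :: "'v graph \<Rightarrow> nat" where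
  "graph_curling_number G = Max (curling_number ` degree_sequences G)"

definition compound_curling_number :: "'v graph \<Rightarrow> nat" where
  "compound_curling_number G =
     (\<Prod>d \<in> degree G ` verts G. card {v \<in> verts G. degree G v = d})"

end

theory Submission
  imports Defs "HOL.Binomial_Plus"
begin

text \<open>
  For any finite graph with a vertex, the curling number is the largest multiplicity of a degree
  (\<open>graph_curling_number_eq_max_multiplicity\<close>): every entry of \<open>Y\<close> occurs at least \<open>k\<close> times in
  \<open>X \<circ> Y\<^sup>k\<close>, so no arrangement curls more often than its most frequent entry occurs, and moving all
  copies of that entry to the end gives a \<open>Y\<close> of length one for which equality holds. Both claims
  are therefore statements about the multiplicities of the degrees.

  In the set-graph on \<open>n\<close> elements, a vertex \<open>B\<close> is adjacent to all subsets except those contained in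
  the complement of \<open>B\<close> and \<open>B\<close> itself, so its degree is \<open>2\<^sup>n - 2\<^bsup>n - |B|\<^esup> - 1\<close>. This is strictly
  increasing in \<open>|B|\<close>; the vertices of a given degree are thus precisely the subsets of one fixed
  size \<open>i\<close> with \<open>1 \<le> i \<le> n\<close>, and the multiplicities are the binomial coefficients \<open>n choose i\<close>.
  Their product is the compound curling number, and the largest of them is the central one.
\<close>

section \<open>Curling numbers and multiplicities\<close>

lemma count_mset_concat_replicate:
  "count (mset (concat (replicate k Y))) y = k * count (mset Y) y"
  by (induction k) auto

lemma repetitions_le_count:
  assumes "S = X @ concat (replicate k Y)" and "y \<in> set Y"
  shows "k \<le> count (mset S) y"
proof -
  have "1 \<le> count (mset Y) y"
    using assms(2) by (simp add: Suc_le_eq)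
  then have "k * 1 \<le> k * count (mset Y) y"
    by (rule mult_le_mono2)
  also have "\<dots> = count (mset (concat (replicate k Y))) y"
    by (rule count_mset_concat_replicate[symmetric])
  also have "\<dots> \<le> count (mset S) y"
    by (simp add: assms(1))
  finally show ?thesis
    by simp
qed

lemma repetitions_le_length:
  assumes "S = X @ concat (replicate k Y)" and "Y \<noteq> []"
  shows "k \<le> length S"
proof -
  have "k \<le> count (mset S) (hd Y)"
    using assms by (intro repetitions_le_count) auto
  also have "\<dots> \<le> length S"
    using count_le_size[of "mset S" "hd Y"] by simp
  finally show ?thesis .
qed

lemma finite_repetitions:
  "finite {k. \<exists>X Y. Y \<noteq> [] \<and> S = X @ concat (replicate k Y)}"
  by (rule finite_subset[of _ "{..length S}"]) (use repetitions_le_length in blast, simp)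

lemma curling_number_le:
  assumes "\<And>y. y \<in> set S \<Longrightarrow> count (mset S) y \<le> m"
  shows "curling_number S \<le> m"
  unfolding curling_number_def
proof (rule Max.boundedI[OF finite_repetitions])
  have "\<exists>X Y. Y \<noteq> [] \<and> S = X @ concat (replicate 0 Y)"
    by (rule exI[of _ S], rule exI[of _ "[0]"]) simp
  then show "{k. \<exists>X Y. Y \<noteq> [] \<and> S = X @ concat (replicate k Y)} \<noteq> {}"
    by blast
next
  fix k
  assume "k \<in> {k. \<exists>X Y. Y \<noteq> [] \<and> S = X @ concat (replicate k Y)}"
  then obtain X Y where Y: "Y \<noteq> []" and S: "S = X @ concat (replicate k Y)"
    by blast
  show "k \<le> m"
  \<comment> \<open>For \<open>k = 0\<close> the block \<open>Y\<close> need not occur in \<open>S\<close>, so the hypothesis says nothing about it.\<close>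
  proof (cases "k = 0")
    case False
    then have "hd Y \<in> set S"
      using Y S by auto
    moreover have "k \<le> count (mset S) (hd Y)"
      using repetitions_le_count[OF S] Y by simp
    ultimately show ?thesis
      using assms le_trans by blast
  qed simp
qed

lemma curling_number_append_replicate_ge:
  "k \<le> curling_number (X @ replicate k y)"
  unfolding curling_number_def
proof (rule Max_ge[OF finite_repetitions])
  have "concat (replicate k [y]) = replicate k y"
    by (induction k) auto
  then have "[y] \<noteq> [] \<and> X @ replicate k y = X @ concat (replicate k [y])"
    by simp
  then show "k \<in> {j. \<exists>X' Y. Y \<noteq> [] \<and> X @ replicate k y = X' @ concat (replicate j Y)}"
    by blast
qed

lemma count_degree_sequence:
  assumes "finite (verts G)" and "S \<in> degree_sequences G"
  shows "count (mset S) d = card {v \<in> verts G. degree G v = d}"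
proof -
  have "count (mset S) d = (\<Sum>v \<in> degree G -` {d} \<inter> verts G. count (mset_set (verts G)) v)"
    using assms by (simp add: degree_sequences_def count_image_mset)
  also have "\<dots> = card (degree G -` {d} \<inter> verts G)"
    using assms by simp
  also have "degree G -` {d} \<inter> verts G = {v \<in> verts G. degree G v = d}"
    by auto
  finally show ?thesis .
qed

lemma finite_degree_sequences: "finite (degree_sequences G)"
proof -
  obtain S0 where "mset S0 = image_mset (degree G) (mset_set (verts G))"
    using ex_mset by blast
  then have "degree_sequences G = {S. mset S = mset S0}"
    by (simp add: degree_sequences_def)
  then show ?thesis
    by (simp only: mset_eq_finite)
qed

text \<open>All arrangements share the same multiplicities, so the upper bound \<open>curling_number_le\<close> is
  uniform over them; collecting the copies of a most frequent degree in a suffix attains it.\<close>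

lemma graph_curling_number_eq_max_multiplicity:
  assumes fin: "finite (verts G)" and ne: "verts G \<noteq> {}"
  shows "graph_curling_number G =
         Max ((\<lambda>d. card {v \<in> verts G. degree G v = d}) ` degree G ` verts G)"
    (is "_ = Max (?mult ` ?D)")
proof (rule antisym)
  have fin_mult: "finite (?mult ` ?D)"
    using fin by simp
  have "Max (?mult ` ?D) \<in> ?mult ` ?D"
    using fin ne by (intro Max_in) auto
  then obtain d where d: "?mult d = Max (?mult ` ?D)"
    by auto
  obtain S0 where S0: "mset S0 = image_mset (degree G) (mset_set (verts G))"
    using ex_mset by blast
  then have S0_arr: "S0 \<in> degree_sequences G"
    by (simp add: degree_sequences_def)
  define S where "S = filter (\<lambda>x. x \<noteq> d) S0 @ replicate (?mult d) d"
  have "mset S = mset S0"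
    using count_degree_sequence[OF fin S0_arr, of d]
    by (intro multiset_eqI) (simp add: S_def)
  then have S_arr: "S \<in> degree_sequences G"
    using S0 by (simp add: degree_sequences_def)
  have "?mult d \<le> curling_number S"
    unfolding S_def by (rule curling_number_append_replicate_ge)
  also have "\<dots> \<le> graph_curling_number G"
    unfolding graph_curling_number_def
    using finite_degree_sequences S_arr by (intro Max_ge) auto
  finally show "Max (?mult ` ?D) \<le> graph_curling_number G"
    by (simp only: d)

  have "curling_number T \<le> Max (?mult ` ?D)" if T: "T \<in> degree_sequences G" for T
  proof (rule curling_number_le)
    fix y
    assume "y \<in> set T"
    then have "y \<in># image_mset (degree G) (mset_set (verts G))"
      using T unfolding degree_sequences_def by (simp flip: set_mset_mset)
    then have "y \<in> ?D"
      using fin by simp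
    then show "count (mset T) y \<le> Max (?mult ` ?D)"
      unfolding count_degree_sequence[OF fin T] using fin_mult by (intro Max_ge) auto
  qed
  then show "graph_curling_number G \<le> Max (?mult ` ?D)"
    unfolding graph_curling_number_def
    using finite_degree_sequences S_arr by (intro Max.boundedI) auto
qed

section \<open>Degrees in a set-graph\<close>

lemma verts_set_graph: "verts (set_graph A) = {B. B \<subseteq> A \<and> B \<noteq> {}}"
  by (simp add: set_graph_def)

text \<open>The neighbours of \<open>B\<close> are counted by complement: a subset fails to meet \<open>B\<close> exactly when
  it lies in \<open>A - B\<close>. The empty set is among these, which also removes it from the count.\<close>

lemma degree_set_graph:
  assumes fin: "finite A" and B: "B \<subseteq> A" "B \<noteq> {}"
  shows "degree (set_graph A) B = 2 ^ card A - 2 ^ (card A - card B) - 1"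
proof -
  define N where "N = Pow A - Pow (A - B) - {B}"
  have N_iff: "C \<in> N \<longleftrightarrow> C \<subseteq> A \<and> C \<noteq> B \<and> B \<inter> C \<noteq> {}" for C
    unfolding N_def by auto
  have "{e \<in> edges (set_graph A). B \<in> e} = (\<lambda>C. {B, C}) ` N"
  proof (rule set_eqI)
    fix e
    show "e \<in> {e \<in> edges (set_graph A). B \<in> e} \<longleftrightarrow> e \<in> (\<lambda>C. {B, C}) ` N"
    proof
      assume "e \<in> {e \<in> edges (set_graph A). B \<in> e}"
      then obtain C D where CD: "e = {C, D}" "C \<subseteq> A" "D \<subseteq> A" "C \<noteq> D" "C \<inter> D \<noteq> {}"
        and "B \<in> {C, D}"
        unfolding set_graph_def by auto
      then consider "B = C" | "B = D"
        by blast
      then show "e \<in> (\<lambda>C. {B, C}) ` N"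
      proof cases
        case 1
        then have "D \<in> N" and "e = {B, D}"
          using CD by (simp_all add: N_iff)
        then show ?thesis
          by blast
      next
        case 2
        then have "C \<in> N" and "e = {B, C}"
          using CD by (simp_all add: N_iff Int_commute insert_commute)
        then show ?thesis
          by blast
      qed
    next
      assume "e \<in> (\<lambda>C. {B, C}) ` N"
      then obtain C where e: "e = {B, C}" and "C \<in> N"
        by (rule imageE)
      then have C: "C \<subseteq> A" "C \<noteq> B" "B \<inter> C \<noteq> {}"
        by (simp_all add: N_iff)
      have "B \<subseteq> A \<and> B \<noteq> {} \<and> C \<subseteq> A \<and> C \<noteq> {} \<and> B \<noteq> C \<and> B \<inter> C \<noteq> {}"
        using B C by blast
      then have "e \<in> edges (set_graph A)"
        unfolding set_graph_def e graph.simps by blast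
      then show "e \<in> {e \<in> edges (set_graph A). B \<in> e}"
        using e by simp
    qed
  qed
  moreover have "inj_on (\<lambda>C. {B, C}) N"
    by (auto simp: inj_on_def doubleton_eq_iff)
  ultimately have "degree (set_graph A) B = card N"
    unfolding degree_def by (simp add: card_image)
  also have "\<dots> = card (Pow A - Pow (A - B)) - 1"
    unfolding N_def using B by (intro card_Diff_singleton) auto
  also have "card (Pow A - Pow (A - B)) = card (Pow A) - card (Pow (A - B))"
    using fin by (intro card_Diff_subset) auto
  also have "\<dots> = 2 ^ card A - 2 ^ (card A - card B)"
    using fin B by (simp add: card_Pow card_Diff_subset finite_subset)
  finally show ?thesis .
qed

definition set_graph_degree :: "nat \<Rightarrow> nat \<Rightarrow> nat" where
  "set_graph_degree n i = 2 ^ n - 2 ^ (n - i) - 1"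

text \<open>The truncating subtractions lose nothing in this range, because \<open>2\<^bsup>n - i\<^esup> < 2\<^sup>n\<close> for
  \<open>i \<ge> 1\<close>. At \<open>i = 0\<close> truncation would make the value 0, which for \<open>n = 1\<close> is also the value at
  \<open>i = 1\<close>.\<close>

lemma inj_on_set_graph_degree: "inj_on (set_graph_degree n) {1..n}"
proof (rule inj_onI)
  fix i j
  assume ij: "i \<in> {1..n}" "j \<in> {1..n}" and eq: "set_graph_degree n i = set_graph_degree n j"
  have "(2::nat) ^ (n - i) < 2 ^ n" "(2::nat) ^ (n - j) < 2 ^ n"
    using ij by (auto intro!: power_strict_increasing)
  then have "(2::nat) ^ (n - i) = 2 ^ (n - j)"
    using eq unfolding set_graph_degree_def by linarith
  then have "n - i = n - j"
    by simp
  then show "i = j"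
    using ij by auto
qed

lemma card_vertex_set_graph:
  assumes "finite A" and "B \<in> verts (set_graph A)"
  shows "card B \<in> {1..card A}"
proof -
  have "B \<subseteq> A" "B \<noteq> {}"
    using assms(2) by (auto simp: verts_set_graph)
  then have "0 < card B" "card B \<le> card A"
    using assms(1) by (simp_all add: card_gt_0_iff card_mono finite_subset)
  then show ?thesis
    by simp
qed

lemma degree_image_set_graph:
  assumes fin: "finite A"
  shows "degree (set_graph A) ` verts (set_graph A) = set_graph_degree (card A) ` {1..card A}"
proof -
  have "card ` verts (set_graph A) = {1..card A}"
  proof
    show "card ` verts (set_graph A) \<subseteq> {1..card A}"
      using card_vertex_set_graph[OF fin] by blast
    show "{1..card A} \<subseteq> card ` verts (set_graph A)"
    proof
      fix i
      assume i: "i \<in> {1..card A}"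
      then obtain B where "B \<subseteq> A" "card B = i"
        using obtain_subset_with_card_n[of i A] by auto
      moreover from this i have "B \<noteq> {}"
        by auto
      ultimately show "i \<in> card ` verts (set_graph A)"
        by (auto simp: verts_set_graph)
    qed
  qed
  moreover have "degree (set_graph A) ` verts (set_graph A) =
      set_graph_degree (card A) ` card ` verts (set_graph A)"
    unfolding image_image using fin
    by (intro image_cong) (auto simp: verts_set_graph degree_set_graph set_graph_degree_def)
  ultimately show ?thesis
    by simp
qed

lemma degree_multiplicity_set_graph:
  assumes fin: "finite A" and i: "i \<in> {1..card A}"
  shows "card {B \<in> verts (set_graph A). degree (set_graph A) B = set_graph_degree (card A) i} =
         card A choose i"
proof -
  have deg_iff: "degree (set_graph A) B = set_graph_degree (card A) i \<longleftrightarrow> card B = i"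
    if "B \<in> verts (set_graph A)" for B
  proof -
    have "degree (set_graph A) B = set_graph_degree (card A) (card B)"
      using that fin by (simp add: verts_set_graph degree_set_graph set_graph_degree_def)
    then show ?thesis
      using inj_on_eq_iff[OF inj_on_set_graph_degree card_vertex_set_graph[OF fin that] i] by simp
  qed
  have "{B \<in> verts (set_graph A). degree (set_graph A) B = set_graph_degree (card A) i} =
      {B \<in> verts (set_graph A). card B = i}"
    using deg_iff by blast
  also have "\<dots> = {B. B \<subseteq> A \<and> card B = i}"
    using i by (auto simp: verts_set_graph)
  finally show ?thesis
    using n_subsets[OF fin] by simp
qed

text \<open>The index \<open>i = 0\<close> is excluded, but the central index is itself 0 when \<open>n = 1\<close>; passing to
  \<open>n - n div 2\<close>, which is positive, gives the same coefficient by symmetry.\<close>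

lemma Max_binomial_positive_index:
  assumes "0 < n"
  shows "Max ((\<lambda>i. n choose i) ` {1..n}) = n choose (n div 2)"
proof (rule Max_eqI)
  have "n - n div 2 \<in> {1..n}"
    using assms by auto
  moreover have "n choose (n div 2) = n choose (n - n div 2)"
    by (rule binomial_symmetric) simp
  ultimately show "n choose (n div 2) \<in> (\<lambda>i. n choose i) ` {1..n}"
    by blast
qed (auto intro: binomial_maximum)

theorem theorem4p4:
  fixes A :: "'a set" and n :: nat
  assumes "finite A" and "A \<noteq> {}" and "card A = n"
  shows "graph_curling_number (set_graph A) = n choose (n div 2) \<and>
         compound_curling_number (set_graph A) = (\<Prod>i=1..n. n choose i)"
proof
  let ?G = "set_graph A"
  let ?mult = "\<lambda>d. card {B \<in> verts ?G. degree ?G B = d}"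
  have n: "0 < n"
    using assms by (auto simp: card_gt_0_iff)
  have mult: "?mult (set_graph_degree n i) = n choose i" if "i \<in> {1..n}" for i
    using degree_multiplicity_set_graph[of A i] assms that by simp
  have degrees: "degree ?G ` verts ?G = set_graph_degree n ` {1..n}"
    using degree_image_set_graph assms by blast
  have "finite (verts ?G)" "verts ?G \<noteq> {}"
    using assms by (auto simp: verts_set_graph)
  then have "graph_curling_number ?G = Max (?mult ` set_graph_degree n ` {1..n})"
    unfolding degrees[symmetric] by (rule graph_curling_number_eq_max_multiplicity)
  also have "?mult ` set_graph_degree n ` {1..n} = (\<lambda>i. n choose i) ` {1..n}"
    unfolding image_image using mult by (intro image_cong) auto
  also have "Max \<dots> = n choose (n div 2)"
    using n by (rule Max_binomial_positive_index)
  finally show "graph_curling_number ?G = n choose (n div 2)" .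

  have "compound_curling_number ?G = (\<Prod>i=1..n. ?mult (set_graph_degree n i))"
    unfolding compound_curling_number_def degrees
    using prod.reindex[OF inj_on_set_graph_degree] by simp
  also have "\<dots> = (\<Prod>i=1..n. n choose i)"
    using mult by (intro prod.cong) auto
  finally show "compound_curling_number ?G = (\<Prod>i=1..n. n choose i)" .
qed

end
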